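(* Let $1<d_1<d_2<d_3$ be integers with $\gcd(d_1,d_2)=1$ such that $\{d_1,d_2,d_3\}$ is a minimal generating set of the semigroup $S(d_1,d_2,d_3)$, let $\Delta=\Delta(d_1,d_2,d_3)$ and $\Phi(z)=\sum_{s\in\Delta}z^s$. For $1\le q\le d_1-1$ let $p_t(q)=\min\{p\ge1:\ d_1d_2-pd_1-qd_2\in\Delta\}$ and $\lambda_q=d_1d_2-(p_t(q)-1)d_1-qd_2$. Then $$(1-z^{d_1})\Phi(z)=\sum_{q=1}^{d_1-1}z^q-\sum_{q=1}^{d_1-1}z^{\lambda_q}.$$
   Context: $S(d_1,d_2,d_3)$ is the set of nonnegative integer combinations of $d_1,d_2,d_3$; minimal means no $d_i$ is a nonnegative integer combination of the other two. $\Delta(d_1,d_2,d_3)$ is the set of positive integers not in $S(d_1,d_2,d_3)$. (For each $q$ the set over which the minimum defining $p_t(q)$ is taken is nonempty.) *)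

theory Defs
  imports "HOL-Number_Theory.Cong"
begin

definition combos2 :: "nat \<Rightarrow> nat \<Rightarrow> nat set" where
  "combos2 a b = {x * a + y * b | x y. True}"

definition semigroup3 :: "nat \<Rightarrow> nat \<Rightarrow> nat \<Rightarrow> nat set" where
  "semigroup3 d1 d2 d3 = {x * d1 + y * d2 + w * d3 | x y w. True}"

definition minimal_generators :: "nat \<Rightarrow> nat \<Rightarrow> nat \<Rightarrow> bool" where
  "minimal_generators d1 d2 d3 \<longleftrightarrow>
     d1 \<notin> combos2 d2 d3 \<and> d2 \<notin> combos2 d1 d3 \<and> d3 \<notin> combos2 d1 d2"

definition gaps :: "nat \<Rightarrow> nat \<Rightarrow> nat \<Rightarrow> nat set" where
  "gaps d1 d2 d3 = {s. 0 < s \<and> s \<notin> semigroup3 d1 d2 d3}"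

text \<open>For coprime \<open>d1\<close>, \<open>d2\<close> the set of gaps is finite (lemma \<open>finite_gaps\<close> below), so this
  is a genuine finite sum. The argument ranges over an arbitrary commutative ring, hence an
  identity for all \<open>z\<close> includes the identity of polynomials in an indeterminate.\<close>

definition Phi :: "nat \<Rightarrow> nat \<Rightarrow> nat \<Rightarrow> 'a::comm_ring_1 \<Rightarrow> 'a" where
  "Phi d1 d2 d3 z = (\<Sum>s\<in>gaps d1 d2 d3. z ^ s)"

text \<open>The differences are formed in the integers, where they may be negative (and then are not
  gaps). The minimum is over a nonempty set (lemma \<open>p_t_exists\<close> below), and the resulting
  integer \<open>lam\<close> is positive (lemma \<open>lam_pos\<close>), so it may serve as an exponent via \<open>nat\<close>.\<close>

definition p_t :: "nat \<Rightarrow> nat \<Rightarrow> nat \<Rightarrow> nat \<Rightarrow> nat" where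
  "p_t d1 d2 d3 q =
     (LEAST p. 1 \<le> p \<and> int d1 * int d2 - int p * int d1 - int q * int d2 \<in> int ` gaps d1 d2 d3)"

definition lam :: "nat \<Rightarrow> nat \<Rightarrow> nat \<Rightarrow> nat \<Rightarrow> int" where
  "lam d1 d2 d3 q =
     int d1 * int d2 - (int (p_t d1 d2 d3 q) - 1) * int d1 - int q * int d2"

lemma finite_gaps:
  assumes "0 < d1" "coprime d1 d2"
  shows "finite (gaps d1 d2 d3)"
proof (rule finite_subset)
  show "gaps d1 d2 d3 \<subseteq> {..<d1 * d2}"
  proof
    fix n assume n: "n \<in> gaps d1 d2 d3"
    show "n \<in> {..<d1 * d2}"
    proof (rule ccontr)
      assume "n \<notin> {..<d1 * d2}"
      then have le: "d1 * d2 \<le> n" by simp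
      obtain x where x: "[d2 * x = 1] (mod d1)"
        using cong_solve_coprime_nat[of d2 d1] assms(2) by (auto simp: coprime_commute)
      define y where "y = (x * n) mod d1"
      have "[d2 * y = d2 * (x * n)] (mod d1)"
        unfolding y_def by (intro cong_mult cong_refl) (simp add: cong_def)
      also have "d2 * (x * n) = (d2 * x) * n" by simp
      also have "[(d2 * x) * n = 1 * n] (mod d1)" by (intro cong_mult x cong_refl)
      finally have c: "[n = d2 * y] (mod d1)" by (simp add: cong_sym_eq)
      have "y < d1" unfolding y_def using assms(1) by simp
      then have "d2 * y \<le> d1 * d2" by (metis less_imp_le mult.commute mult_le_mono1)
      with le have yn: "d2 * y \<le> n" by (meson le_trans)
      from c yn have "d1 dvd n - d2 * y" by (simp add: cong_altdef_nat)
      then obtain k where "n - d2 * y = d1 * k" by (elim dvdE)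
      with yn have "n = k * d1 + y * d2 + 0 * d3" by (simp add: algebra_simps)
      then have "n \<in> semigroup3 d1 d2 d3" unfolding semigroup3_def by blast
      with n show False by (simp add: gaps_def)
    qed
  qed
qed simp

lemma small_gaps:
  assumes "0 < r" "r < d1" "d1 < d2" "d2 < d3"
  shows "r \<in> gaps d1 d2 d3"
proof -
  have "r \<noteq> x * d1 + y * d2 + w * d3" for x y w
  proof
    assume r: "r = x * d1 + y * d2 + w * d3"
    have "x = 0" "y = 0" "w = 0"
      using r assms by (cases x; cases y; cases w; simp)+
    with r assms show False by simp
  qed
  with assms(1) show ?thesis by (auto simp: gaps_def semigroup3_def)
qed

lemma p_t_exists:
  assumes "1 < d1" "d1 < d2" "d2 < d3" "coprime d1 d2" "1 \<le> q" "q \<le> d1 - 1"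
  shows "\<exists>p. 1 \<le> p \<and> int d1 * int d2 - int p * int d1 - int q * int d2 \<in> int ` gaps d1 d2 d3"
proof -
  define m where "m = (d1 - q) * d2"
  have "\<not> d1 dvd m"
    using assms nat_dvd_not_less[of "d1 - q" d1]
    by (simp add: m_def coprime_dvd_mult_left_iff)
  then have "0 < m mod d1" by (simp add: dvd_eq_mod_eq_0)
  moreover have "m mod d1 < d1" using assms by simp
  ultimately have r: "m mod d1 \<in> gaps d1 d2 d3" using assms small_gaps by blast
  have "1 * d1 \<le> (d1 - q) * d2" using assms by (intro mult_le_mono) auto
  then have "1 \<le> m div d1" using assms by (simp add: m_def less_eq_div_iff_mult_less_eq)
  moreover have "int d1 * int d2 - int (m div d1) * int d1 - int q * int d2 = int (m mod d1)"
  proof -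
    have "int m = int d1 * int d2 - int q * int d2"
      using assms by (simp add: m_def of_nat_diff algebra_simps)
    moreover have "int m = int (m div d1) * int d1 + int (m mod d1)"
      by (metis div_mult_mod_eq of_nat_add of_nat_mult)
    ultimately show ?thesis by simp
  qed
  ultimately show ?thesis using r by (metis imageI)
qed

lemma lam_pos:
  assumes "1 < d1" "d1 < d2" "d2 < d3" "coprime d1 d2" "1 \<le> q" "q \<le> d1 - 1"
  shows "0 < lam d1 d2 d3 q"
proof -
  have "int d1 * int d2 - int (p_t d1 d2 d3 q) * int d1 - int q * int d2 \<in> int ` gaps d1 d2 d3"
    unfolding p_t_def using LeastI_ex[OF p_t_exists[OF assms]] by blast
  then have "0 < int d1 * int d2 - int (p_t d1 d2 d3 q) * int d1 - int q * int d2"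
    by (auto simp: gaps_def)
  then show ?thesis using assms by (simp add: lam_def algebra_simps)
qed

end

theory Submission
  imports Defs
begin

text \<open>Let \<open>G\<close> be the set of gaps. Then \<open>(1 - z^d\<^sub>1) \<Phi>(z)\<close> is the sum of \<open>z^s\<close> over
  \<open>G - (G + d\<^sub>1)\<close> minus the sum over \<open>(G + d\<^sub>1) - G\<close>. Since \<open>G\<close> is closed under subtracting \<open>d\<^sub>1\<close>,
  the first difference is \<open>{1, \<dots>, d\<^sub>1 - 1}\<close>. The numbers \<open>\<lambda>\<^sub>q\<close> lie in the second difference and
  are pairwise incongruent modulo \<open>d\<^sub>1\<close>; as both differences have the same cardinality
  \<open>d\<^sub>1 - 1\<close>, they exhaust it.\<close>

lemma semigroup3_add_generator1:
  assumes "s \<in> semigroup3 d1 d2 d3"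
  shows "s + d1 \<in> semigroup3 d1 d2 d3"
proof -
  obtain x y w where "s = x * d1 + y * d2 + w * d3"
    using assms by (auto simp: semigroup3_def)
  then have "s + d1 = Suc x * d1 + y * d2 + w * d3" by simp
  then show ?thesis unfolding semigroup3_def by blast
qed

lemma mult_generator_notin_gaps:
  shows "k * d1 \<notin> gaps d1 d2 d3" and "k * d2 \<notin> gaps d1 d2 d3"
proof -
  have "k * d1 = k * d1 + 0 * d2 + 0 * d3" "k * d2 = 0 * d1 + k * d2 + 0 * d3" by simp_all
  then show "k * d1 \<notin> gaps d1 d2 d3" "k * d2 \<notin> gaps d1 d2 d3"
    unfolding gaps_def semigroup3_def by blast+
qed

text \<open>A gap \<open>s\<close> above \<open>d1\<close> is a shifted gap: if
  \<open>s - d1\<close> were in the semigroup, so would be \<open>s\<close>. Positive numbers below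
  \<open>d1\<close> are gaps, but too small to be shifts.\<close>

lemma gaps_diff_shift:
  assumes "d1 < d2" "d2 < d3"
  shows "gaps d1 d2 d3 - (\<lambda>s. s + d1) ` gaps d1 d2 d3 = {1..d1 - 1}"
proof (intro equalityI subsetI)
  fix s assume s: "s \<in> gaps d1 d2 d3 - (\<lambda>s. s + d1) ` gaps d1 d2 d3"
  have "s < d1"
  proof (rule ccontr)
    assume "\<not> s < d1"
    \<comment> \<open>This case is separate because \<open>s - d1\<close> must be positive to be a
      gap.\<close>
    moreover have "s \<noteq> d1" using s mult_generator_notin_gaps(1)[of 1 d1 d2 d3] by auto
    ultimately have "d1 < s" by simp
    then have "s - d1 \<in> gaps d1 d2 d3"
      using s semigroup3_add_generator1[of "s - d1" d1 d2 d3] by (auto simp: gaps_def)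
    with \<open>d1 < s\<close> have "s \<in> (\<lambda>s. s + d1) ` gaps d1 d2 d3"
      by (intro image_eqI[of _ _ "s - d1"]) auto
    with s show False by simp
  qed
  with s show "s \<in> {1..d1 - 1}" by (auto simp: gaps_def)
next
  fix s assume "s \<in> {1..d1 - 1}"
  then show "s \<in> gaps d1 d2 d3 - (\<lambda>s. s + d1) ` gaps d1 d2 d3"
    using assms small_gaps[of s d1 d2 d3] by auto
qed

text \<open>\<open>lam\<close> lies one step of \<open>d1\<close> above the gap \<open>g\<close>
  reached at the minimal \<open>p\<close>. If it were a gap too, \<open>p - 1\<close> would
  contradict minimality, unless \<open>p = 1\<close>.\<close>

lemma lam_in_shift_diff_gaps:
  assumes "1 < d1" "d1 < d2" "d2 < d3" "coprime d1 d2" "1 \<le> q" "q \<le> d1 - 1"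
  shows "nat (lam d1 d2 d3 q) \<in> (\<lambda>s. s + d1) ` gaps d1 d2 d3 - gaps d1 d2 d3"
proof -
  define P where "P p \<longleftrightarrow> 1 \<le> p \<and>
    int d1 * int d2 - int p * int d1 - int q * int d2 \<in> int ` gaps d1 d2 d3" for p
  define p where "p = p_t d1 d2 d3 q"
  have p_Least: "p = (LEAST p. P p)" unfolding p_def p_t_def P_def ..
  have "P p" unfolding p_Least
    by (rule LeastI_ex) (use p_t_exists[OF assms] in \<open>simp add: P_def\<close>)
  then obtain g where g: "g \<in> gaps d1 d2 d3"
    "int d1 * int d2 - int p * int d1 - int q * int d2 = int g" and p: "1 \<le> p"
    unfolding P_def by auto
  \<comment> \<open>This is the minimised expression at index \<open>p - 1\<close>; truncated
    subtraction is harmless since \<open>1 \<le> p\<close>.\<close>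
  have lam: "lam d1 d2 d3 q = int d1 * int d2 - int (p - 1) * int d1 - int q * int d2"
    using p by (simp add: lam_def p_def of_nat_diff)
  have "lam d1 d2 d3 q = int (g + d1)"
    using g(2) by (simp add: lam_def p_def algebra_simps)
  then have nat_lam: "nat (lam d1 d2 d3 q) = g + d1" by (simp only: nat_int)
  have "g + d1 \<notin> gaps d1 d2 d3"
  proof
    assume gap: "g + d1 \<in> gaps d1 d2 d3"
    show False
    proof (cases "p = 1")
      case True
      have "int (g + d1) = int ((d1 - q) * d2)"
        using True \<open>lam d1 d2 d3 q = int (g + d1)\<close> lam assms
        by (simp add: of_nat_diff algebra_simps)
      then have "g + d1 = (d1 - q) * d2" by (simp only: of_nat_eq_iff)
      with gap show False using mult_generator_notin_gaps(2) by metis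
    next
      case False
      have "lam d1 d2 d3 q \<in> int ` gaps d1 d2 d3"
        using gap \<open>lam d1 d2 d3 q = int (g + d1)\<close> by blast
      with False p lam have "P (p - 1)" unfolding P_def by simp
      then have "p \<le> p - 1" unfolding p_Least by (rule Least_le)
      with p show False by simp
    qed
  qed
  with g(1) nat_lam show ?thesis by auto
qed

text \<open>Modulo \<open>d1\<close>, \<open>lam\<close> is congruent to \<open>- q * d2\<close>,
  and \<open>d2\<close> can be cancelled by coprimality.\<close>

lemma inj_on_lam:
  assumes "coprime d1 d2"
  shows "inj_on (lam d1 d2 d3) {1..d1 - 1}"
proof (rule inj_onI)
  fix q r assume qr: "q \<in> {1..d1 - 1}" "r \<in> {1..d1 - 1}"
    and eq: "lam d1 d2 d3 q = lam d1 d2 d3 r"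
  have "(int q - int r) * int d2 = int d1 * (int (p_t d1 d2 d3 r) - int (p_t d1 d2 d3 q))"
    using eq by (simp add: lam_def algebra_simps)
  then have "int d1 dvd (int q - int r) * int d2" by simp
  then have "int d1 dvd int q - int r" using assms by (simp add: coprime_dvd_mult_left_iff)
  then have "[q = r] (mod d1)" by (simp add: cong_iff_dvd_diff flip: cong_int_iff)
  moreover have "q < d1" "r < d1" using qr by auto
  ultimately show "q = r" by (simp add: cong_def)
qed

lemma shift_diff_gaps:
  assumes "1 < d1" "d1 < d2" "d2 < d3" "coprime d1 d2"
  shows "(\<lambda>q. nat (lam d1 d2 d3 q)) ` {1..d1 - 1} =
    (\<lambda>s. s + d1) ` gaps d1 d2 d3 - gaps d1 d2 d3" (is "?L = ?S - ?G")
    and "inj_on (\<lambda>q. nat (lam d1 d2 d3 q)) {1..d1 - 1}"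
proof -
  have fin: "finite ?G" using assms by (intro finite_gaps) auto
  show inj: "inj_on (\<lambda>q. nat (lam d1 d2 d3 q)) {1..d1 - 1}"
  proof (rule inj_onI)
    fix q r assume qr: "q \<in> {1..d1 - 1}" "r \<in> {1..d1 - 1}"
      and eq: "nat (lam d1 d2 d3 q) = nat (lam d1 d2 d3 r)"
    \<comment> \<open>Positivity keeps \<open>nat\<close> from merging distinct values.\<close>
    have "0 < lam d1 d2 d3 q" "0 < lam d1 d2 d3 r"
      using qr lam_pos[OF assms] by auto
    with eq have "lam d1 d2 d3 q = lam d1 d2 d3 r" by simp
    then show "q = r" using qr by (rule inj_onD[OF inj_on_lam[OF assms(4)]])
  qed
  have "card ?S = card ?G" by (simp add: card_image)
  \<comment> \<open>Both differences remove the same intersection from finite sets of equal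
    size.\<close>
  then have "card (?S - ?G) = card (?G - ?S)"
    using fin card_Diff_subset_Int[of ?S ?G] card_Diff_subset_Int[of ?G ?S]
    by (simp add: Int_commute)
  also have "\<dots> = card ?L" using assms by (simp only: gaps_diff_shift card_image[OF inj])
  finally have "card ?L = card (?S - ?G)" ..
  moreover have "?L \<subseteq> ?S - ?G"
    using lam_in_shift_diff_gaps[OF assms] by (intro image_subsetI) simp
  ultimately show "?L = ?S - ?G" using fin by (intro card_subset_eq) auto
qed

lemma sum_diff_eq_sum_Diffs:
  fixes f :: "'b \<Rightarrow> 'a::ab_group_add"
  assumes "finite A" "finite B"
  shows "sum f A - sum f B = sum f (A - B) - sum f (B - A)"
  using sum.Int_Diff[OF assms(1), of f B] sum.Int_Diff[OF assms(2), of f A]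
  by (simp add: Int_commute)

theorem theorem3:
  fixes d1 d2 d3 :: nat and z :: "'a::comm_ring_1"
  assumes "1 < d1" and "d1 < d2" and "d2 < d3"
    and "gcd d1 d2 = 1"
    and "minimal_generators d1 d2 d3"
  shows "(1 - z ^ d1) * Phi d1 d2 d3 z =
    (\<Sum>q = 1..d1 - 1. z ^ q) - (\<Sum>q = 1..d1 - 1. z ^ nat (lam d1 d2 d3 q))"
proof -
  let ?G = "gaps d1 d2 d3" and ?S = "(\<lambda>s. s + d1) ` gaps d1 d2 d3"
  have cop: "coprime d1 d2" using assms(4) by (simp add: coprime_iff_gcd_eq_1)
  have fin: "finite ?G" using assms(1) cop by (intro finite_gaps) auto
  \<comment> \<open>Multiplying by \<open>z ^ d1\<close> shifts every exponent by
    \<open>d1\<close>.\<close>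
  have "(\<Sum>s\<in>?S. z ^ s) = z ^ d1 * Phi d1 d2 d3 z"
    by (simp add: Phi_def sum.reindex power_add sum_distrib_left mult.commute)
  then have "(1 - z ^ d1) * Phi d1 d2 d3 z = (\<Sum>s\<in>?G. z ^ s) - (\<Sum>s\<in>?S. z ^ s)"
    by (simp add: Phi_def left_diff_distrib)
  also have "\<dots> = (\<Sum>s\<in>?G - ?S. z ^ s) - (\<Sum>s\<in>?S - ?G. z ^ s)"
    using fin by (intro sum_diff_eq_sum_Diffs) auto
  also have "(\<Sum>s\<in>?G - ?S. z ^ s) = (\<Sum>q = 1..d1 - 1. z ^ q)"
    using assms by (simp add: gaps_diff_shift)
  also have "(\<Sum>s\<in>?S - ?G. z ^ s) = (\<Sum>q = 1..d1 - 1. z ^ nat (lam d1 d2 d3 q))"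
    unfolding shift_diff_gaps(1)[OF assms(1-3) cop, symmetric]
    by (subst sum.reindex[OF shift_diff_gaps(2)[OF assms(1-3) cop]]) (simp add: o_def)
  finally show ?thesis .
qed

end
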